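(* Let $n \ge 1$. For linear subspaces $\mathcal{X}$ and $\mathcal{Y}$ of $\mathbb{R}^n$ with respective dimensions $p, q \in \mathbb{N}\setminus\{0\}$ (not necessarily equal), and with respective orthonormal bases given by the columns of matrices $X \in \mathbb{R}^{n \times p}$ and $Y \in \mathbb{R}^{n \times q}$, define $$\mathcal{D}_2(\mathcal{X},\mathcal{Y}) := \sqrt{\max(p,q) - \| X^\top Y \|_F^2}.$$ Then $\mathcal{D}_2$ is a metric, for all $p, q \in \mathbb{N}\setminus\{0\}$; that is, $\mathcal{D}_2$ is a metric on the set of all nonzero linear subspaces of $\mathbb{R}^n$, where the subspaces may have different dimensions.
   Context: $\|\cdot\|_F$ denotes the Frobenius norm, $\|A\|_F = \sqrt{\operatorname{tr}(A^\top A)}$. The value $\|X^\top Y\|_F$ depends only on the subspaces $\mathcal{X}$, $\mathcal{Y}$, not on the chosen orthonormal bases. A metric on a set $S$ is a function $\rho$ of two arguments on $S$ such that for all $s_1,s_2,s_3\in S$: (1) $\rho(s_1,s_2)\ge 0$; (2) $\rho(s_1,s_2)=0$ if and only if $s_1=s_2$; (3) $\rho(s_1,s_2)=\rho(s_2,s_1)$; (4) $\rho(s_1,s_2)\le \rho(s_1,s_3)+\rho(s_3,s_2)$. *)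

theory Defs
  imports Complex_Main "Jordan_Normal_Form.Gram_Schmidt"
begin

text \<open>Vectors of \<open>\<real>\<^sup>n\<close> are the elements of \<open>carrier_vec n\<close>, since the number of columns
  of the matrices below varies with the subspaces. \<open>VectorSpace.subspace\<close> is a locale
  predicate with the vector space as its last argument; a subspace \<open>W\<close> becomes a
  vector space by restricting the carrier.\<close>

definition linear_subspace :: "nat \<Rightarrow> real vec set \<Rightarrow> bool" where
  "linear_subspace n W \<longleftrightarrow> VectorSpace.subspace class_ring W (module_vec TYPE(real) n)"

definition subspace_dim :: "nat \<Rightarrow> real vec set \<Rightarrow> nat" where
  "subspace_dim n W = vectorspace.dim class_ring ((module_vec TYPE(real) n)\<lparr>carrier := W\<rparr>)"

definition nonzero_subspaces :: "nat \<Rightarrow> real vec set set" where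
  "nonzero_subspaces n = {W. linear_subspace n W \<and> W \<noteq> {0\<^sub>v n}}"

text \<open>Distinctness of the columns, which \<open>set (cols X)\<close> forgets, follows from their
  orthonormality.\<close>

definition orthonormal_basis_mat :: "nat \<Rightarrow> real vec set \<Rightarrow> real mat \<Rightarrow> bool" where
  "orthonormal_basis_mat n W X \<longleftrightarrow>
     X \<in> carrier_mat n (subspace_dim n W) \<and>
     vectorspace.basis class_ring ((module_vec TYPE(real) n)\<lparr>carrier := W\<rparr>) (set (cols X)) \<and>
     (\<forall>i < dim_col X. \<forall>j < dim_col X. col X i \<bullet> col X j = (if i = j then 1 else 0))"

definition mat_trace :: "real mat \<Rightarrow> real" where
  "mat_trace A = (\<Sum>i < dim_row A. A $$ (i, i))"

definition frobenius_norm :: "real mat \<Rightarrow> real" where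
  "frobenius_norm A = sqrt (mat_trace (A\<^sup>T * A))"

text \<open>The bases are arbitrary choices: they exist for every subspace (\<open>orthonormal_basis_mat_exists\<close>
  below), and the value is the same for all of them (\<open>D2_eq\<close> below). As \<open>sqrt\<close> on the
  reals is total with \<open>sqrt (- x) = - sqrt x\<close>, nonnegativity of \<open>D2\<close> entails that the radicand is
  nonnegative.\<close>

definition D2 :: "nat \<Rightarrow> real vec set \<Rightarrow> real vec set \<Rightarrow> real" where
  "D2 n V W =
     (let X = (SOME X. orthonormal_basis_mat n V X);
          Y = (SOME Y. orthonormal_basis_mat n W Y)
      in sqrt (real (max (subspace_dim n V) (subspace_dim n W)) - (frobenius_norm (X\<^sup>T * Y))\<^sup>2))"

text \<open>The axioms are required only on \<open>S\<close>, whereas the locale \<open>Metric_space\<close> of HOL-Analysis also asks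
  for nonnegativity and symmetry outside the carrier.\<close>

definition metric_on :: "'a set \<Rightarrow> ('a \<Rightarrow> 'a \<Rightarrow> real) \<Rightarrow> bool" where
  "metric_on S \<rho> \<longleftrightarrow>
     (\<forall>s1\<in>S. \<forall>s2\<in>S. \<forall>s3\<in>S.
        \<rho> s1 s2 \<ge> 0 \<and>
        (\<rho> s1 s2 = 0 \<longleftrightarrow> s1 = s2) \<and>
        \<rho> s1 s2 = \<rho> s2 s1 \<and>
        \<rho> s1 s2 \<le> \<rho> s1 s3 + \<rho> s3 s2)"


lemma orthonormal_basis_matD:
  assumes W: "linear_subspace n W" and X: "orthonormal_basis_mat n W X"
  shows "X \<in> carrier_mat n (subspace_dim n W)"
    and "X\<^sup>T * X = 1\<^sub>m (subspace_dim n W)"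
    and "W = {X *\<^sub>v c | c. c \<in> carrier_vec (subspace_dim n W)}"
proof -
  interpret vec_space "TYPE(real)" n .
  show car: "X \<in> carrier_mat n (subspace_dim n W)"
    using X by (simp add: orthonormal_basis_mat_def)
  show "X\<^sup>T * X = 1\<^sub>m (subspace_dim n W)"
    using X car by (intro eq_matI) (auto simp: orthonormal_basis_mat_def)
  have sub: "submodule class_ring W V"
    using W by (simp add: linear_subspace_def VectorSpace.subspace_def)
  have vsW: "vectorspace class_ring (V\<lparr>carrier := W\<rparr>)"
    using W subspace_is_vs by (simp add: linear_subspace_def)
  interpret w: vectorspace class_ring "V\<lparr>carrier := W\<rparr>" by (rule vsW)
  have bas: "w.basis (set (cols X))" using X by (simp add: orthonormal_basis_mat_def)
  hence c: "set (cols X) \<subseteq> W" and g: "w.span (set (cols X)) = W"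
    by (auto simp: w.basis_def)
  have "span (set (cols X)) = W"
    using span_li_not_depend(1)[OF c sub] g by simp
  hence "W = col_space X" by (simp only: col_space_def)
  also have "\<dots> = {X *\<^sub>v c | c. c \<in> carrier_vec (subspace_dim n W)}"
    unfolding col_space_eq[OF car] carrier_matD[OF car]
    using mult_mat_vec_carrier[OF car] by blast
  finally show "W = {X *\<^sub>v c | c. c \<in> carrier_vec (subspace_dim n W)}" .
qed

lemma orthonormal_basis_mat_exists:
  assumes W: "linear_subspace n W"
  shows "\<exists>X. orthonormal_basis_mat n W X"
proof -
  interpret cof_vec_space n "TYPE(real)" .
  have sub: "submodule class_ring W V"
    using W by (simp add: linear_subspace_def VectorSpace.subspace_def)
  have vsW: "vectorspace class_ring (V\<lparr>carrier := W\<rparr>)"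
    using W subspace_is_vs by (simp add: linear_subspace_def)
  interpret w: vectorspace class_ring "V\<lparr>carrier := W\<rparr>" by (rule vsW)
  have Wc: "W \<subseteq> carrier_vec n" using submodule.subset[OF sub] by simp
  have small: "finite A \<and> card A \<le> dim"
    if "A \<subseteq> carrier (V\<lparr>carrier := W\<rparr>) \<and> w.lin_indpt A" for A
  proof -
    have A: "A \<subseteq> W" using that by simp
    have "lin_indpt A" using that span_li_not_depend(2)[OF A sub] by simp
    thus ?thesis using li_le_dim[OF fin_dim, of A] A Wc by auto
  qed
  have "\<exists>A. finite A \<and> maximal A (\<lambda>S. S \<subseteq> carrier (V\<lparr>carrier := W\<rparr>) \<and> w.lin_indpt S)"
  proof (rule maximal_exists)
    show "{} \<subseteq> carrier (V\<lparr>carrier := W\<rparr>) \<and> w.lin_indpt {}"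
      unfolding w.lin_dep_def by blast
  qed (rule small)
  then obtain B where fB: "finite B" and B: "w.basis B"
    using w.max_li_is_basis by blast
  have BW: "B \<subseteq> W" and Bli: "lin_indpt B" and Bspan: "span B = W"
    using B span_li_not_depend[of B W] sub by (auto simp: w.basis_def)
  have dimB: "subspace_dim n W = card B"
    unfolding subspace_dim_def by (rule w.dim_basis[OF fB B])
  obtain ws where ws: "set ws = B" "distinct ws"
    using finite_distinct_list[OF fB] by blast
  have lenws: "length ws = card B" using ws distinct_card by metis
  define us where "us = gram_schmidt n ws"
  have wsc: "set ws \<subseteq> carrier_vec n" using ws BW Wc by auto
  note gs = gram_schmidt_result[OF wsc ws(2) _ us_def]
  have us: "span (set us) = W" "corthogonal us" "set us \<subseteq> carrier_vec n" "length us = card B"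
    using gs Bli Bspan ws lenws by auto
  have usdot: "us ! i \<bullet> us ! j = 0 \<longleftrightarrow> i \<noteq> j" if "i < length us" "j < length us" for i j
    using corthogonalD[OF us(2) that] by simp
  have pos: "us ! i \<bullet> us ! i > 0" if i: "i < length us" for i
  proof -
    have "us ! i \<bullet> us ! i \<ge> 0"
      by (auto simp: scalar_prod_def intro!: sum_nonneg)
    thus ?thesis using usdot[OF i i] by linarith
  qed
  define zs where "zs = map (\<lambda>u. (1 / sqrt (u \<bullet> u)) \<cdot>\<^sub>v u) us"
  have lenz: "length zs = length us" by (simp add: zs_def)
  have zc: "set zs \<subseteq> carrier_vec n" using us(3) by (auto simp: zs_def)
  have zdot: "zs ! i \<bullet> zs ! j = (if i = j then 1 else 0)"
    if i: "i < length us" and j: "j < length us" for i j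
  proof -
    have ci: "us ! i \<in> carrier_vec n" "us ! j \<in> carrier_vec n" using us(3) i j nth_mem by blast+
    have "zs ! i \<bullet> zs ! j = (us ! i \<bullet> us ! j) / (sqrt (us ! i \<bullet> us ! i) * sqrt (us ! j \<bullet> us ! j))"
      using ci i j by (simp add: zs_def)
    thus ?thesis using pos[OF i] usdot[OF i j] by auto
  qed
  have "set zs \<subseteq> span (set us)"
  proof
    fix z assume "z \<in> set zs"
    then obtain u where u: "u \<in> set us" "z = (1 / sqrt (u \<bullet> u)) \<cdot>\<^sub>v u"
      unfolding zs_def by force
    have "u \<in> span (set us)" using in_own_span[OF us(3)] u(1) by (rule subsetD)
    thus "z \<in> span (set us)" unfolding u(2) by (rule smult_in_span[OF us(3)])
  qed
  hence s1: "span (set zs) \<subseteq> span (set us)" by (rule span_subsetI[OF us(3)])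
  have "us ! i \<in> span (set zs)" if i: "i < length us" for i
  proof -
    have "us ! i = sqrt (us ! i \<bullet> us ! i) \<cdot>\<^sub>v zs ! i"
      using i pos[OF i] by (simp add: zs_def smult_smult_assoc)
    moreover have "zs ! i \<in> span (set zs)"
      using in_own_span[OF zc] i lenz nth_mem by (metis subsetD)
    ultimately show ?thesis using smult_in_span[OF zc] by metis
  qed
  hence "set us \<subseteq> span (set zs)" by (metis in_set_conv_nth subsetI)
  hence "span (set us) \<subseteq> span (set zs)" by (rule span_subsetI[OF zc])
  with s1 us(1) have zspan: "span (set zs) = W" by simp
  have zW: "set zs \<subseteq> W" using in_own_span[OF zc] zspan by simp
  have "w.basis (set zs)"
  proof (rule w.dim_gen_is_basis)
    show "w.gen_set (set zs)" using span_li_not_depend(1)[OF zW sub] zspan by simp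
    show "card (set zs) \<le> w.dim"
      using card_length[of zs] lenz us(4) dimB by (simp add: subspace_dim_def)
  qed (use zW in auto)
  moreover have "cols (mat_of_cols n zs) = zs" using zc by simp
  ultimately have "orthonormal_basis_mat n W (mat_of_cols n zs)"
    unfolding orthonormal_basis_mat_def using lenz us(4) dimB zdot zc
    by (auto simp: col_mat_of_cols subset_iff)
  thus ?thesis by blast
qed

lemma mat_trace_mult_comm:
  assumes "A \<in> carrier_mat r c" "B \<in> carrier_mat c r"
  shows "mat_trace (A * B) = mat_trace (B * A)"
proof -
  have "mat_trace (A * B) = (\<Sum>i<r. \<Sum>j<c. A $$ (i, j) * B $$ (j, i))"
    using assms by (simp add: mat_trace_def scalar_prod_def atLeast0LessThan)
  also have "\<dots> = (\<Sum>j<c. \<Sum>i<r. B $$ (j, i) * A $$ (i, j))"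
    by (subst sum.swap) (simp add: mult.commute)
  also have "\<dots> = mat_trace (B * A)"
    using assms by (simp add: mat_trace_def scalar_prod_def atLeast0LessThan)
  finally show ?thesis .
qed

lemma orthonormal_basis_mat_projection_unique:
  assumes W: "linear_subspace n W"
    and X: "orthonormal_basis_mat n W X" and X': "orthonormal_basis_mat n W X'"
  shows "X * X\<^sup>T = X' * X'\<^sup>T"
proof -
  let ?p = "subspace_dim n W"
  have absorb: "(A * A\<^sup>T) * (B * B\<^sup>T) = B * B\<^sup>T"
    if A: "orthonormal_basis_mat n W A" and B: "orthonormal_basis_mat n W B" for A B
  proof -
    note a = orthonormal_basis_matD[OF W A] and b = orthonormal_basis_matD[OF W B]
    note cars = a(1) b(1)
    have "(A * A\<^sup>T) * B = B"
    proof (rule eq_matI)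
      fix i j assume "i < dim_row B" "j < dim_col B"
      hence i: "i < n" and j: "j < ?p" using cars by auto
      have "col B j = B *\<^sub>v unit_vec ?p j" using j cars by (intro eq_vecI) auto
      moreover have "B *\<^sub>v unit_vec ?p j \<in> {B *\<^sub>v c | c. c \<in> carrier_vec ?p}"
        using unit_vec_carrier by blast
      ultimately have "col B j \<in> W" using b(3) by (metis (no_types, lifting))
      then obtain c where c: "c \<in> carrier_vec ?p" "col B j = A *\<^sub>v c" using a(3) by blast
      have AA: "A * A\<^sup>T \<in> carrier_mat n n" using cars by auto
      have "col ((A * A\<^sup>T) * B) j = (A * A\<^sup>T) *\<^sub>v (A *\<^sub>v c)"
        using col_mult2[OF AA cars(2) j] c(2) by metis
      also have "\<dots> = A *\<^sub>v (A\<^sup>T *\<^sub>v (A *\<^sub>v c))"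
        using cars c by (intro assoc_mult_mat_vec[of _ n ?p _ n]) auto
      also have "A\<^sup>T *\<^sub>v (A *\<^sub>v c) = (A\<^sup>T * A) *\<^sub>v c"
        using cars c by (intro assoc_mult_mat_vec[of _ ?p n _ ?p, symmetric]) auto
      also have "A *\<^sub>v ((A\<^sup>T * A) *\<^sub>v c) = col B j" using c a(2) by simp
      finally have "col ((A * A\<^sup>T) * B) j $ i = col B j $ i" by (rule arg_cong)
      moreover have "dim_row ((A * A\<^sup>T) * B) = n" "dim_col ((A * A\<^sup>T) * B) = ?p"
        using cars by auto
      ultimately show "((A * A\<^sup>T) * B) $$ (i, j) = B $$ (i, j)"
        using i j cars index_col by simp
    qed (use cars in auto)
    thus ?thesis
      using cars assoc_mult_mat[of "A * A\<^sup>T" n n B ?p "B\<^sup>T" n] by auto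
  qed
  note x = orthonormal_basis_matD(1)[OF W X] and x' = orthonormal_basis_matD(1)[OF W X']
  have "X * X\<^sup>T = ((X' * X'\<^sup>T) * (X * X\<^sup>T))\<^sup>T"
    using absorb[OF X' X] x by (simp add: transpose_mult[of _ n ?p _ n])
  also have "\<dots> = (X * X\<^sup>T) * (X' * X'\<^sup>T)"
    using x x' by (simp add: transpose_mult[of _ n n _ n] transpose_mult[of _ n ?p _ n])
  also have "\<dots> = X' * X'\<^sup>T" by (rule absorb[OF X X'])
  finally show ?thesis .
qed

lemma frobenius_norm_transpose_mult:
  assumes X: "X \<in> carrier_mat n p" and Y: "Y \<in> carrier_mat n q"
  shows "frobenius_norm (X\<^sup>T * Y) = sqrt (mat_trace ((X * X\<^sup>T) * (Y * Y\<^sup>T)))"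
proof -
  have "mat_trace ((X\<^sup>T * Y)\<^sup>T * (X\<^sup>T * Y)) = mat_trace (Y\<^sup>T * ((X * X\<^sup>T) * Y))"
    using X Y by (simp add: transpose_mult[of _ p n _ q] assoc_mult_mat[of _ q n _ p _ q]
        assoc_mult_mat[of _ n p _ n _ q])
  also have "\<dots> = mat_trace (((X * X\<^sup>T) * Y) * Y\<^sup>T)"
    using X Y by (intro mat_trace_mult_comm[of _ q n]) auto
  also have "\<dots> = mat_trace ((X * X\<^sup>T) * (Y * Y\<^sup>T))"
    using X Y by (intro arg_cong[where f = mat_trace] assoc_mult_mat[of _ n n _ q _ n]) auto
  finally show ?thesis by (simp add: frobenius_norm_def)
qed

lemma D2_eq:
  assumes V: "linear_subspace n V" and W: "linear_subspace n W"
    and X: "orthonormal_basis_mat n V X" and Y: "orthonormal_basis_mat n W Y"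
  shows "D2 n V W =
    sqrt (real (max (subspace_dim n V) (subspace_dim n W)) - (frobenius_norm (X\<^sup>T * Y))\<^sup>2)"
proof -
  let ?X = "SOME X. orthonormal_basis_mat n V X" and ?Y = "SOME Y. orthonormal_basis_mat n W Y"
  have X': "orthonormal_basis_mat n V ?X" and Y': "orthonormal_basis_mat n W ?Y"
    using X Y by (auto intro: someI)
  have "frobenius_norm (?X\<^sup>T * ?Y) = frobenius_norm (X\<^sup>T * Y)"
    using orthonormal_basis_mat_projection_unique[OF V X X']
      orthonormal_basis_mat_projection_unique[OF W Y Y']
    by (simp add: frobenius_norm_transpose_mult[OF orthonormal_basis_matD(1)[OF V X] orthonormal_basis_matD(1)[OF W Y]]
        frobenius_norm_transpose_mult[OF orthonormal_basis_matD(1)[OF V X'] orthonormal_basis_matD(1)[OF W Y']])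
  thus ?thesis by (simp add: D2_def)
qed

end

theory Submission
  imports Defs "HOL-Analysis.L2_Norm"
begin

text \<open>Let \<open>P\<close> and \<open>Q\<close> be the orthogonal projections onto subspaces of dimensions \<open>p\<close> and \<open>q\<close>.
  Since \<open>\<parallel>P\<parallel>\<^sup>2 = tr P = p\<close> and \<open>\<parallel>X\<^sup>T Y\<parallel>\<^sup>2 = tr (P Q)\<close> in the Frobenius norm,
  expanding \<open>\<parallel>P - Q\<parallel>\<^sup>2 = p + q - 2 tr (P Q)\<close> and using \<open>2 max p q = p + q + \<bar>p - q\<bar>\<close> turns the
  radicand into a sum of two squares of distances,
  \<open>2 D2\<^sup>2 = (sqrt \<bar>p - q\<bar>)\<^sup>2 + \<parallel>P - Q\<parallel>\<^sup>2\<close> (\<open>D2_eq_orth_proj\<close>).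

  Both summands are squares of pseudometrics: \<open>sqrt \<bar>p - q\<bar>\<close> because the square root is subadditive,
  and \<open>\<parallel>P - Q\<parallel>\<close> because the Frobenius norm is a Euclidean norm. The Euclidean combination of two
  pseudometrics is again a pseudometric, by the triangle inequality in the plane. It separates
  subspaces because a subspace is the range of its projection (\<open>subspace_eq_range_orth_proj\<close>).\<close>

section \<open>The Frobenius norm as a Euclidean norm\<close>

lemma mat_trace_transpose_mult:
  assumes "A \<in> carrier_mat r c" "B \<in> carrier_mat r c"
  shows "mat_trace (A\<^sup>T * B) = (\<Sum>(i, j)\<in>{..<r} \<times> {..<c}. A $$ (i, j) * B $$ (i, j))"
proof -
  have "mat_trace (A\<^sup>T * B) = (\<Sum>j<c. \<Sum>i<r. A $$ (i, j) * B $$ (i, j))"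
    using assms by (simp add: mat_trace_def scalar_prod_def atLeast0LessThan)
  also have "\<dots> = (\<Sum>i<r. \<Sum>j<c. A $$ (i, j) * B $$ (i, j))"
    by (rule sum.swap)
  finally show ?thesis by (simp add: sum.cartesian_product)
qed

lemma frobenius_norm_eq_L2_set:
  assumes "A \<in> carrier_mat r c"
  shows "frobenius_norm A = L2_set (\<lambda>ij. A $$ ij) ({..<r} \<times> {..<c})"
  using mat_trace_transpose_mult[OF assms assms]
  by (simp add: frobenius_norm_def L2_set_def power2_eq_square split_def)

lemma frobenius_norm_nonneg: "frobenius_norm A \<ge> 0"
  using frobenius_norm_eq_L2_set[of A "dim_row A" "dim_col A"] by simp

lemma frobenius_norm_power2: "(frobenius_norm A)\<^sup>2 = mat_trace (A\<^sup>T * A)"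
  using frobenius_norm_nonneg[of A] by (simp add: frobenius_norm_def)

lemma frobenius_norm_minus_commute:
  assumes "A \<in> carrier_mat r c" "B \<in> carrier_mat r c"
  shows "frobenius_norm (A - B) = frobenius_norm (B - A)"
  unfolding frobenius_norm_eq_L2_set[OF minus_carrier_mat[OF assms(2)]]
    frobenius_norm_eq_L2_set[OF minus_carrier_mat[OF assms(1)]] L2_set_def
  using assms by (intro arg_cong[where f = sqrt] sum.cong) (auto simp: power2_commute)

lemma frobenius_norm_triangle_diff:
  assumes "A \<in> carrier_mat r c" "B \<in> carrier_mat r c" "C \<in> carrier_mat r c"
  shows "frobenius_norm (A - B) \<le> frobenius_norm (A - C) + frobenius_norm (C - B)"
proof -
  let ?I = "{..<r} \<times> {..<c}"
  have "L2_set (\<lambda>ij. (A - B) $$ ij) ?I = L2_set (\<lambda>ij. (A - C) $$ ij + (C - B) $$ ij) ?I"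
    using assms by (intro L2_set_cong) auto
  also have "\<dots> \<le> L2_set (\<lambda>ij. (A - C) $$ ij) ?I + L2_set (\<lambda>ij. (C - B) $$ ij) ?I"
    by (rule L2_set_triangle_ineq)
  finally show ?thesis
    using assms by (simp add: frobenius_norm_eq_L2_set[of _ r c] minus_carrier_mat)
qed

lemma frobenius_norm_diff_eq_0_iff:
  assumes "A \<in> carrier_mat r c" "B \<in> carrier_mat r c"
  shows "frobenius_norm (A - B) = 0 \<longleftrightarrow> A = B"
proof -
  have "frobenius_norm (A - B) = 0 \<longleftrightarrow> (\<forall>ij\<in>{..<r} \<times> {..<c}. (A - B) $$ ij = 0)"
    unfolding frobenius_norm_eq_L2_set[OF minus_carrier_mat[OF assms(2)]]
    by (simp add: L2_set_eq_0_iff)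
  also have "\<dots> \<longleftrightarrow> A = B"
    using assms by (auto intro: eq_matI)
  finally show ?thesis .
qed

lemma frobenius_norm_diff_power2:
  assumes A: "A \<in> carrier_mat r c" and B: "B \<in> carrier_mat r c"
  shows "(frobenius_norm (A - B))\<^sup>2
    = (frobenius_norm A)\<^sup>2 + (frobenius_norm B)\<^sup>2 - 2 * mat_trace (A\<^sup>T * B)"
proof -
  let ?I = "{..<r} \<times> {..<c}"
  have "(frobenius_norm (A - B))\<^sup>2 = (\<Sum>(i, j)\<in>?I. (A - B) $$ (i, j) * (A - B) $$ (i, j))"
    using A B by (simp add: frobenius_norm_power2 mat_trace_transpose_mult[of _ r c] minus_carrier_mat)
  also have "\<dots> = (\<Sum>(i, j)\<in>?I. A $$ (i, j) * A $$ (i, j) + B $$ (i, j) * B $$ (i, j)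
      - 2 * (A $$ (i, j) * B $$ (i, j)))"
    using A B by (intro sum.cong) (auto simp: algebra_simps)
  also have "\<dots> = (frobenius_norm A)\<^sup>2 + (frobenius_norm B)\<^sup>2 - 2 * mat_trace (A\<^sup>T * B)"
    using A B by (simp add: frobenius_norm_power2 mat_trace_transpose_mult[of _ r c]
        split_def sum.distrib sum_subtractf sum_distrib_left)
  finally show ?thesis .
qed

section \<open>Orthogonal projections\<close>

definition orth_proj :: "nat \<Rightarrow> real vec set \<Rightarrow> real mat" where
  "orth_proj n W = (let X = (SOME X. orthonormal_basis_mat n W X) in X * X\<^sup>T)"

lemma orth_proj_eq:
  assumes "linear_subspace n W" "orthonormal_basis_mat n W X"
  shows "orth_proj n W = X * X\<^sup>T"
  unfolding orth_proj_def Let_def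
  using assms by (intro orthonormal_basis_mat_projection_unique) (auto intro: someI)

lemma orth_proj_carrier:
  assumes W: "linear_subspace n W"
  shows "orth_proj n W \<in> carrier_mat n n"
proof -
  obtain X where X: "orthonormal_basis_mat n W X" using orthonormal_basis_mat_exists[OF W] ..
  show ?thesis using orth_proj_eq[OF W X] orthonormal_basis_matD(1)[OF W X] by simp
qed

lemma orth_proj_symmetric:
  assumes W: "linear_subspace n W"
  shows "(orth_proj n W)\<^sup>T = orth_proj n W"
proof -
  obtain X where X: "orthonormal_basis_mat n W X" using orthonormal_basis_mat_exists[OF W] ..
  show ?thesis using orth_proj_eq[OF W X] orthonormal_basis_matD(1)[OF W X]
    by (simp add: transpose_mult[of _ n "subspace_dim n W" _ n])
qed

text \<open>By cyclicity of the trace, \<open>tr (X X\<^sup>T X X\<^sup>T) = tr (X\<^sup>T X X\<^sup>T X)\<close>, and \<open>X\<^sup>T X\<close> is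
  the identity matrix whose size is the dimension.\<close>

lemma frobenius_norm_orth_proj_power2:
  assumes W: "linear_subspace n W"
  shows "(frobenius_norm (orth_proj n W))\<^sup>2 = real (subspace_dim n W)"
proof -
  obtain X where X: "orthonormal_basis_mat n W X" using orthonormal_basis_mat_exists[OF W] ..
  note x = orthonormal_basis_matD[OF W X]
  have "frobenius_norm (X\<^sup>T * X) = sqrt (mat_trace (orth_proj n W * orth_proj n W))"
    using frobenius_norm_transpose_mult[OF x(1) x(1)] orth_proj_eq[OF W X] by simp
  hence "frobenius_norm (orth_proj n W) = frobenius_norm (1\<^sub>m (subspace_dim n W))"
    using x(2) by (simp add: frobenius_norm_def[of "orth_proj n W"] orth_proj_symmetric[OF W])
  thus ?thesis by (simp add: frobenius_norm_power2 mat_trace_def)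
qed

text \<open>As \<open>X\<^sup>T X\<close> is the identity, \<open>X X\<^sup>T\<close> fixes every \<open>X c\<close>. This is what makes
  the subspace recoverable from its projection, hence \<open>D2\<close> definite.\<close>

lemma subspace_eq_range_orth_proj:
  assumes W: "linear_subspace n W"
  shows "W = {orth_proj n W *\<^sub>v v | v. v \<in> carrier_vec n}"
proof -
  obtain X where X: "orthonormal_basis_mat n W X" using orthonormal_basis_mat_exists[OF W] ..
  let ?p = "subspace_dim n W"
  note x = orthonormal_basis_matD[OF W X]
  have proj: "orth_proj n W *\<^sub>v v = X *\<^sub>v (X\<^sup>T *\<^sub>v v)" if "v \<in> carrier_vec n" for v
    unfolding orth_proj_eq[OF W X] using x(1) that by (intro assoc_mult_mat_vec[of _ n ?p _ n]) auto
  have "X *\<^sub>v c = orth_proj n W *\<^sub>v (X *\<^sub>v c)" if c: "c \<in> carrier_vec ?p" for c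
  proof -
    have "X\<^sup>T *\<^sub>v (X *\<^sub>v c) = (X\<^sup>T * X) *\<^sub>v c"
      using x(1) c by (intro assoc_mult_mat_vec[of _ ?p n _ ?p, symmetric]) auto
    also have "\<dots> = c" using x(2) c by simp
    finally show ?thesis using proj[of "X *\<^sub>v c"] x(1) c by simp
  qed
  hence "{X *\<^sub>v c | c. c \<in> carrier_vec ?p} \<subseteq> {orth_proj n W *\<^sub>v v | v. v \<in> carrier_vec n}"
    using mult_mat_vec_carrier[OF x(1)] by blast
  moreover have "{orth_proj n W *\<^sub>v v | v. v \<in> carrier_vec n} \<subseteq> {X *\<^sub>v c | c. c \<in> carrier_vec ?p}"
    using proj mult_mat_vec_carrier[of "X\<^sup>T" ?p n] x(1) by auto
  ultimately show ?thesis using x(3) by simp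
qed

section \<open>The distance between subspaces of different dimensions\<close>

text \<open>The term \<open>\<bar>p - q\<bar>\<close> is written as the square of \<open>sqrt \<bar>p - q\<bar>\<close> to exhibit \<open>D2\<close> as
  the length, up to the factor \<open>sqrt 2\<close>, of the plane vector of the two pseudometrics.\<close>

lemma D2_eq_orth_proj:
  assumes V: "linear_subspace n V" and W: "linear_subspace n W"
  shows "D2 n V W = sqrt ((sqrt \<bar>real (subspace_dim n V) - real (subspace_dim n W)\<bar>)\<^sup>2
    + (frobenius_norm (orth_proj n V - orth_proj n W))\<^sup>2) / sqrt 2"
proof -
  obtain X where X: "orthonormal_basis_mat n V X" using orthonormal_basis_mat_exists[OF V] ..
  obtain Y where Y: "orthonormal_basis_mat n W Y" using orthonormal_basis_mat_exists[OF W] ..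
  let ?p = "real (subspace_dim n V)" and ?q = "real (subspace_dim n W)"
  let ?t = "mat_trace (orth_proj n V * orth_proj n W)"
  have "frobenius_norm (X\<^sup>T * Y) = sqrt ?t"
    using frobenius_norm_transpose_mult[OF orthonormal_basis_matD(1)[OF V X]
        orthonormal_basis_matD(1)[OF W Y]]
    by (simp add: orth_proj_eq[OF V X] orth_proj_eq[OF W Y])
  moreover from this have "?t \<ge> 0" using frobenius_norm_nonneg[of "X\<^sup>T * Y"] by simp
  ultimately have "(frobenius_norm (X\<^sup>T * Y))\<^sup>2 = ?t" by simp
  moreover have "(frobenius_norm (orth_proj n V - orth_proj n W))\<^sup>2 = ?p + ?q - 2 * ?t"
    using frobenius_norm_diff_power2[OF orth_proj_carrier[OF V] orth_proj_carrier[OF W]]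
    by (simp add: frobenius_norm_orth_proj_power2 orth_proj_symmetric V W)
  ultimately have "real (max (subspace_dim n V) (subspace_dim n W)) - (frobenius_norm (X\<^sup>T * Y))\<^sup>2
    = ((sqrt \<bar>?p - ?q\<bar>)\<^sup>2 + (frobenius_norm (orth_proj n V - orth_proj n W))\<^sup>2) / 2"
    by (auto simp: max_def abs_if field_simps)
  thus ?thesis unfolding D2_eq[OF V W X Y] by (simp only: real_sqrt_divide)
qed

lemma sqrt_abs_diff_triangle:
  fixes a b c :: real
  shows "sqrt \<bar>a - b\<bar> \<le> sqrt \<bar>a - c\<bar> + sqrt \<bar>c - b\<bar>"
proof -
  have "sqrt \<bar>a - b\<bar> \<le> sqrt (\<bar>a - c\<bar> + \<bar>c - b\<bar>)" by simp
  also have "\<dots> \<le> sqrt \<bar>a - c\<bar> + sqrt \<bar>c - b\<bar>" by (rule sqrt_add_le_add_sqrt) auto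
  finally show ?thesis .
qed

lemma D2_triangle:
  assumes U: "linear_subspace n U" and V: "linear_subspace n V" and W: "linear_subspace n W"
  shows "D2 n U W \<le> D2 n U V + D2 n V W"
proof -
  let ?d = "\<lambda>A B. sqrt \<bar>real (subspace_dim n A) - real (subspace_dim n B)\<bar>"
  let ?f = "\<lambda>A B. frobenius_norm (orth_proj n A - orth_proj n B)"
  have "sqrt ((?d U W)\<^sup>2 + (?f U W)\<^sup>2) \<le> sqrt ((?d U V + ?d V W)\<^sup>2 + (?f U V + ?f V W)\<^sup>2)"
    using sqrt_abs_diff_triangle
      frobenius_norm_triangle_diff[OF orth_proj_carrier[OF U] orth_proj_carrier[OF W] orth_proj_carrier[OF V]]
    by (intro real_sqrt_le_mono add_mono power_mono) (auto simp: frobenius_norm_nonneg)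
  also have "\<dots> \<le> sqrt ((?d U V)\<^sup>2 + (?f U V)\<^sup>2) + sqrt ((?d V W)\<^sup>2 + (?f V W)\<^sup>2)"
    by (rule real_sqrt_sum_squares_triangle_ineq)
  finally show ?thesis
    unfolding D2_eq_orth_proj[OF U W] D2_eq_orth_proj[OF U V] D2_eq_orth_proj[OF V W] add_divide_distrib[symmetric]
    by (rule divide_right_mono) simp
qed

lemma D2_commute:
  assumes V: "linear_subspace n V" and W: "linear_subspace n W"
  shows "D2 n V W = D2 n W V"
  unfolding D2_eq_orth_proj[OF V W] D2_eq_orth_proj[OF W V]
    frobenius_norm_minus_commute[OF orth_proj_carrier[OF V] orth_proj_carrier[OF W]]
  by (simp add: abs_minus_commute)

lemma D2_nonneg:
  assumes "linear_subspace n V" "linear_subspace n W"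
  shows "D2 n V W \<ge> 0"
  unfolding D2_eq_orth_proj[OF assms] by simp

lemma D2_eq_0_iff:
  assumes V: "linear_subspace n V" and W: "linear_subspace n W"
  shows "D2 n V W = 0 \<longleftrightarrow> V = W"
proof
  assume "D2 n V W = 0"
  hence "frobenius_norm (orth_proj n V - orth_proj n W) = 0"
    unfolding D2_eq_orth_proj[OF V W] by (simp only: divide_eq_0_iff real_sqrt_eq_zero_cancel_iff sum_power2_eq_zero_iff) simp
  hence "orth_proj n V = orth_proj n W"
    using frobenius_norm_diff_eq_0_iff[OF orth_proj_carrier[OF V] orth_proj_carrier[OF W]] by simp
  thus "V = W" using subspace_eq_range_orth_proj[OF V] subspace_eq_range_orth_proj[OF W] by simp
next
  assume "V = W"
  thus "D2 n V W = 0"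
    unfolding D2_eq_orth_proj[OF V W]
    using frobenius_norm_diff_eq_0_iff[OF orth_proj_carrier[OF V] orth_proj_carrier[OF W]] by simp
qed

theorem theorem2p1:
  fixes n :: nat
  assumes "n \<ge> 1"
  shows "metric_on (nonzero_subspaces n) (D2 n)"
  unfolding metric_on_def nonzero_subspaces_def
  using D2_nonneg D2_eq_0_iff D2_commute D2_triangle by blast

end
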